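(* Let $H\ge 1$ be an integer, $n\ge 1$, let $\Sigma_1,\ldots,\Sigma_n,O$ be finite nonempty sets, and let $f\colon\Sigma_1\times\cdots\times\Sigma_n\to O$ be any function. Then $\mathrm{rk}^{(H)}(f)=\mathrm{dd}^{(H)}(f)$, i.e. the $H$-head rank of $f$ equals the decoder depth of $f$ with $H$ heads.
   Context: **$H$-head rank.** An assignment is a pair $(i,\sigma)$ with $i\in[n]=\{1,\ldots,n\}$, $\sigma\in\Sigma_i$; $A$ is the (finite) set of all assignments. The assignment $(i,\sigma)$ is consistent with $\bar w=(\sigma_1,\ldots,\sigma_n)\in\Sigma_1\times\cdots\times\Sigma_n$ iff $\sigma_i=\sigma$. A permutation of $A$ is a bijection $\tau\colon\{1,\ldots,|A|\}\to A$. The a-query $q_\tau\colon\Sigma_1\times\cdots\times\Sigma_n\to A$ is defined by $q_\tau(\bar w)=\tau(k)$ for the minimal $k$ such that $\tau(k)$ is consistent with $\bar w$. An $H$-degree a-query is a product $q_{\tau_1}\otimes\cdots\otimes q_{\tau_H}\colon\bar w\mapsto(q_{\tau_1}(\bar w),\ldots,q_{\tau_H}(\bar w))$ of $H$ a-queries. A decision tree over a family $\mathcal F$ of queries (functions with domain $\Sigma_1\times\cdots\times\Sigma_n$) is a rooted tree in which each non-leaf node $v$ is labeled by some $q_v\in\mathcal F$ and has exactly $|\mathrm{Im}(q_v)|$ outgoing edges, labeled by the distinct elements of $\mathrm{Im}(q_v)$, and each leaf is labeled by an element of $O$. On input $\bar w$ one descends from the root, at each node $v$ following the edge labeled $q_v(\bar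 w)$, and outputs the label of the leaf reached. The tree computes $f$ if its output on every $\bar w$ is $f(\bar w)$. The depth is the maximal number of edges on a root-to-leaf path. $\mathrm{rk}^{(H)}(f)$ is the minimal depth of a decision tree over $H$-degree a-queries computing $f$. **Attention layer.** A (unique hard-attention) layer with $H$ heads and embedding dimension $d$ is a function $L\colon(\mathbb R^d)^*\to\mathbb R^d$ on nonempty finite sequences given by matrices $Q^{(h)},K^{(h)}\in\mathbb R^{d\times d}$ ($h=1,\ldots,H$), $W_1,W_2\in\mathbb R^{d\times d}$, $W_O\in\mathbb R^{d\times dH}$. On input $(x_1,\ldots,x_m)$, for each $h$ let $i_h$ be the leftmost index $i\in\{1,\ldots,m\}$ maximizing $\langle K^{(h)}x_i,Q^{(h)}x_m\rangle$, and let $\mathrm{head}_h=x_{i_h}$. Let $\mathrm{multihead}=W_O\cdot(\mathrm{head}_1;\ldots;\mathrm{head}_H)\in\mathbb R^d$ ($W_O$ applied to the vertical concatenation). Then $L(x_1,\ldots,x_m)=W_2\cdot\mathrm{ReLU}(W_1(\mathrm{multihead}+x_m))$, with $\mathrm{ReLU}(x)=\max\{0,x\}$ applied coordinatewise. **Decoder depth.** $f$ can be computed by $t$ iterations of a decoder with $H$ heads if there exist $d\in\mathbb N$, an attention layer $L$ with $H$ heads and embedding dimension $d$, a positional encoding $p\colon(\Sigma_1\times\{1\})\cup\cdots\cup(\Sigma_n\times\{n\})\cup\{\mathsf{EoL}\}\to\mathbb R^d$ ($\mathsf{EoL}$ a special symbol), and an arbitrary output function $\alpha\colon\mathbb R^d\to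 O$ such that for every $\bar w=(\sigma_1,\ldots,\sigma_n)$, setting $x_i=p(\sigma_i,i)$, $y_0=p(\mathsf{EoL})$ and $y_{s}=L(x_1,\ldots,x_n,y_0,y_1,\ldots,y_{s-1})$ for $s\ge1$, we have $f(\bar w)=\alpha(y_t)$. $\mathrm{dd}^{(H)}(f)$ is the minimal $t\ge0$ such that $f$ can be computed by $t$ iterations of a decoder with $H$ heads. *)

theory Defs
  imports
    "HOL-Library.FuncSet"
    "HOL-Library.Extended_Nat"
    "Jordan_Normal_Form.Matrix"
begin

section \<open>Input words and a-queries\<close>

text \<open>
  The alphabets are a family \<open>\<Sigma> i\<close>, \<open>i \<in> {1..n}\<close>, of sets over one common type, and a tuple
  \<open>(\<sigma>\<^sub>1, \<dots>, \<sigma>\<^sub>n)\<close> is a function in the dependent (extensional) product.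
\<close>

definition words :: "nat \<Rightarrow> (nat \<Rightarrow> 'a set) \<Rightarrow> (nat \<Rightarrow> 'a) set" where
  "words n \<Sigma> = (\<Pi>\<^sub>E i\<in>{1..n}. \<Sigma> i)"

definition assignments :: "nat \<Rightarrow> (nat \<Rightarrow> 'a set) \<Rightarrow> (nat \<times> 'a) set" where
  "assignments n \<Sigma> = (SIGMA i:{1..n}. \<Sigma> i)"

definition consistent :: "nat \<times> 'a \<Rightarrow> (nat \<Rightarrow> 'a) \<Rightarrow> bool" where
  "consistent a w \<longleftrightarrow> w (fst a) = snd a"

definition is_permutation :: "nat \<Rightarrow> (nat \<Rightarrow> 'a set) \<Rightarrow> (nat \<Rightarrow> nat \<times> 'a) \<Rightarrow> bool" where
  "is_permutation n \<Sigma> \<tau> \<longleftrightarrow>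
     bij_betw \<tau> {1..card (assignments n \<Sigma>)} (assignments n \<Sigma>)"

definition a_query :: "nat \<Rightarrow> (nat \<Rightarrow> 'a set) \<Rightarrow> (nat \<Rightarrow> nat \<times> 'a) \<Rightarrow> (nat \<Rightarrow> 'a) \<Rightarrow> nat \<times> 'a" where
  "a_query n \<Sigma> \<tau> w =
     \<tau> (LEAST k. k \<in> {1..card (assignments n \<Sigma>)} \<and> consistent (\<tau> k) w)"

text \<open>The value of a product of \<open>H\<close> a-queries is the list of length \<open>H\<close> of the individual answers.\<close>

definition a_queries ::
  "nat \<Rightarrow> nat \<Rightarrow> (nat \<Rightarrow> 'a set) \<Rightarrow> ((nat \<Rightarrow> 'a) \<Rightarrow> (nat \<times> 'a) list) set" where
  "a_queries H n \<Sigma> =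
     {\<lambda>w. map (\<lambda>\<tau>. a_query n \<Sigma> \<tau> w) \<tau>s |\<tau>s.
        length \<tau>s = H \<and> (\<forall>\<tau>\<in>set \<tau>s. is_permutation n \<Sigma> \<tau>)}"


section \<open>Decision trees and the \<open>H\<close>-head rank\<close>

text \<open>
  A node carries its query \<open>q\<close> and the children indexed by edge label.  The child function is
  total, but relative to a query domain \<open>D\<close> only the labels in \<open>q ` D\<close> are edges of the tree: the
  values of the child function at other labels are irrelevant to all notions below.
\<close>

datatype ('w, 'r, 'o) dtree = Leaf 'o | Node "'w \<Rightarrow> 'r" "'r \<Rightarrow> ('w, 'r, 'o) dtree"

primrec is_dtree_over :: "'w set \<Rightarrow> ('w \<Rightarrow> 'r) set \<Rightarrow> 'o set \<Rightarrow> ('w, 'r, 'o) dtree \<Rightarrow> bool" where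
  "is_dtree_over D F Out (Leaf c) \<longleftrightarrow> c \<in> Out"
| "is_dtree_over D F Out (Node q ch) \<longleftrightarrow>
     q \<in> F \<and> (\<forall>r\<in>q ` D. is_dtree_over D F Out (ch r))"

primrec dtree_output :: "('w, 'r, 'o) dtree \<Rightarrow> 'w \<Rightarrow> 'o" where
  "dtree_output (Leaf c) w = c"
| "dtree_output (Node q ch) w = dtree_output (ch (q w)) w"

primrec dtree_depth :: "'w set \<Rightarrow> ('w, 'r, 'o) dtree \<Rightarrow> nat" where
  "dtree_depth D (Leaf c) = 0"
| "dtree_depth D (Node q ch) = Suc (Max ((\<lambda>r. dtree_depth D (ch r)) ` q ` D))"

text \<open>
  The minima defining the rank and the decoder depth are taken in \<^typ>\<open>enat\<close>, so that they would
  be \<open>\<infinity>\<close> rather than an arbitrary number if there were no candidate.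
\<close>

definition head_rank ::
  "nat \<Rightarrow> nat \<Rightarrow> (nat \<Rightarrow> 'a set) \<Rightarrow> 'o set \<Rightarrow> ((nat \<Rightarrow> 'a) \<Rightarrow> 'o) \<Rightarrow> enat" where
  "head_rank H n \<Sigma> Out f =
     (INF T \<in> {T. is_dtree_over (words n \<Sigma>) (a_queries H n \<Sigma>) Out T \<and>
                  (\<forall>w\<in>words n \<Sigma>. dtree_output T w = f w)}.
        enat (dtree_depth (words n \<Sigma>) T))"


section \<open>Unique hard-attention layers\<close>

definition leftmost_argmax :: "('b \<Rightarrow> real) \<Rightarrow> 'b list \<Rightarrow> nat" where
  "leftmost_argmax s xs =
     (LEAST i. i < length xs \<and> (\<forall>j<length xs. s (xs ! j) \<le> s (xs ! i)))"

definition attention_head :: "real mat \<Rightarrow> real mat \<Rightarrow> real vec list \<Rightarrow> real vec" where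
  "attention_head Q K xs =
     xs ! leftmost_argmax (\<lambda>x. (K *\<^sub>v x) \<bullet> (Q *\<^sub>v last xs)) xs"

definition concat_vecs :: "'b vec list \<Rightarrow> 'b vec" where
  "concat_vecs vs = foldr (@\<^sub>v) vs vNil"

definition relu :: "real vec \<Rightarrow> real vec" where
  "relu = map_vec (max 0)"

definition layer_output ::
  "nat \<Rightarrow> (nat \<Rightarrow> real mat) \<Rightarrow> (nat \<Rightarrow> real mat) \<Rightarrow> real mat \<Rightarrow> real mat \<Rightarrow> real mat \<Rightarrow>
   real vec list \<Rightarrow> real vec" where
  "layer_output H Q K W1 W2 WO xs =
     (let multihead = WO *\<^sub>v concat_vecs (map (\<lambda>h. attention_head (Q h) (K h) xs) [1..<Suc H])
      in W2 *\<^sub>v relu (W1 *\<^sub>v (multihead + last xs)))"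

definition is_attention_layer :: "nat \<Rightarrow> nat \<Rightarrow> (real vec list \<Rightarrow> real vec) \<Rightarrow> bool" where
  "is_attention_layer H d L \<longleftrightarrow>
     (\<exists>Q K W1 W2 WO.
        (\<forall>h\<in>{1..H}. Q h \<in> carrier_mat d d \<and> K h \<in> carrier_mat d d) \<and>
        W1 \<in> carrier_mat d d \<and> W2 \<in> carrier_mat d d \<and> WO \<in> carrier_mat d (d * H) \<and>
        (\<forall>xs. xs \<noteq> [] \<and> set xs \<subseteq> carrier_vec d \<longrightarrow> L xs = layer_output H Q K W1 W2 WO xs))"


section \<open>Decoders and the decoder depth\<close>

datatype 'a token = Sym 'a nat | EoL

definition tokens :: "nat \<Rightarrow> (nat \<Rightarrow> 'a set) \<Rightarrow> 'a token set" where
  "tokens n \<Sigma> = {Sym \<sigma> i |\<sigma> i. i \<in> {1..n} \<and> \<sigma> \<in> \<Sigma> i} \<union> {EoL}"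

fun decoder_state :: "('b list \<Rightarrow> 'b) \<Rightarrow> 'b list \<Rightarrow> 'b \<Rightarrow> nat \<Rightarrow> 'b" where
  "decoder_state L xs y0 0 = y0"
| "decoder_state L xs y0 (Suc s) =
     L (xs @ map (\<lambda>j. decoder_state L xs y0 j) [0..<Suc s])"

definition decoder_computes ::
  "nat \<Rightarrow> nat \<Rightarrow> (nat \<Rightarrow> 'a set) \<Rightarrow> 'o set \<Rightarrow> ((nat \<Rightarrow> 'a) \<Rightarrow> 'o) \<Rightarrow> nat \<Rightarrow> bool" where
  "decoder_computes H n \<Sigma> Out f t \<longleftrightarrow>
     (\<exists>d L p \<alpha>.
        is_attention_layer H d L \<and>
        p \<in> tokens n \<Sigma> \<rightarrow> carrier_vec d \<and>
        \<alpha> \<in> carrier_vec d \<rightarrow> Out \<and>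
        (\<forall>w\<in>words n \<Sigma>.
           f w = \<alpha> (decoder_state L (map (\<lambda>i. p (Sym (w i) i)) [1..<Suc n]) (p EoL) t)))"

definition decoder_depth ::
  "nat \<Rightarrow> nat \<Rightarrow> (nat \<Rightarrow> 'a set) \<Rightarrow> 'o set \<Rightarrow> ((nat \<Rightarrow> 'a) \<Rightarrow> 'o) \<Rightarrow> enat" where
  "decoder_depth H n \<Sigma> Out f = (INF t \<in> {t. decoder_computes H n \<Sigma> Out f t}. enat t)"

end

theory Submission
  imports Defs "HOL-Library.Product_Lexorder"
begin

text \<open>A decoder is turned into a tree of the same depth because, once the generated tokens are known,
  the leftmost argmax of a head over the input tokens is the answer to the a-query that lists the
  assignments by decreasing score, ties being broken by position. Conversely, a tree is run by a
  decoder whose last token is the one-hot encoding of the current subtree: the bilinear scores then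
  depend arbitrarily on the pair of subtree and assignment, so each head can realise any a-query,
  and a ReLU layer with one unit per pair of a subtree and an answer list looks up the next
  subtree.\<close>

section \<open>From decoders to decision trees\<close>

lemma leftmost_argmax_eqI:
  assumes "i < length xs" "\<And>j. j < length xs \<Longrightarrow> s (xs ! j) \<le> s (xs ! i)"
    and "\<And>j. j < i \<Longrightarrow> s (xs ! j) < s (xs ! i)"
  shows "leftmost_argmax s xs = i"
  unfolding leftmost_argmax_def
proof (rule Least_equality)
  fix y assume "y < length xs \<and> (\<forall>j<length xs. s (xs ! j) \<le> s (xs ! y))"
  then show "i \<le> y" using assms by (meson linorder_not_less)
qed (use assms in auto)

lemma leftmost_argmax_props:
  assumes "xs \<noteq> []"
  shows "leftmost_argmax s xs < length xs"
    and "j < length xs \<Longrightarrow> s (xs ! j) \<le> s (xs ! leftmost_argmax s xs)"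
    and "j < leftmost_argmax s xs \<Longrightarrow> s (xs ! j) < s (xs ! leftmost_argmax s xs)"
proof -
  let ?P = "\<lambda>i. i < length xs \<and> (\<forall>j<length xs. s (xs ! j) \<le> s (xs ! i))"
  have "Max (s ` set xs) \<in> s ` set xs" using assms by (intro Max_in) auto
  then obtain i where "i < length xs" "s (xs ! i) = Max (s ` set xs)"
    by (metis imageE in_set_conv_nth)
  then have "?P i" by simp
  then have P: "?P (leftmost_argmax s xs)" unfolding leftmost_argmax_def by (rule LeastI)
  then show "leftmost_argmax s xs < length xs"
    and max: "j < length xs \<Longrightarrow> s (xs ! j) \<le> s (xs ! leftmost_argmax s xs)" for j by auto
  assume "j < leftmost_argmax s xs"
  then have "\<not> ?P j" unfolding leftmost_argmax_def by (rule not_less_Least)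
  then show "s (xs ! j) < s (xs ! leftmost_argmax s xs)"
    using \<open>j < leftmost_argmax s xs\<close> P by (meson dual_order.strict_trans linorder_not_less order_trans)
qed

text \<open>If some entry of \<open>ys\<close> strictly beats the best entry of \<open>xs\<close>,
  the maximum lies in \<open>ys\<close> for both lists; otherwise ties go to the left and
  \<open>xs ! i\<close> wins in both. A whole block of tokens thus acts on a head only through its
  best entry.\<close>

lemma nth_leftmost_argmax_append:
  assumes "i < length xs" "\<And>j. j < length xs \<Longrightarrow> s (xs ! j) \<le> s (xs ! i)"
    and "\<And>j. j < i \<Longrightarrow> s (xs ! j) < s (xs ! i)"
  shows "(xs @ ys) ! leftmost_argmax s (xs @ ys) = (xs ! i # ys) ! leftmost_argmax s (xs ! i # ys)"
proof (cases "\<forall>j<length ys. s (ys ! j) \<le> s (xs ! i)")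
  case True
  have "leftmost_argmax s (xs @ ys) = i"
    using assms True by (intro leftmost_argmax_eqI) (auto simp: nth_append)
  moreover have "leftmost_argmax s (xs ! i # ys) = 0"
    using True by (intro leftmost_argmax_eqI) (auto simp: nth_Cons split: nat.split)
  ultimately show ?thesis using assms(1) by (simp add: nth_append)
next
  case False
  define m where "m = leftmost_argmax s ys"
  have "ys \<noteq> []" using False by auto
  note m = leftmost_argmax_props[OF this, where s = s, folded m_def]
  have gt: "s (xs ! i) < s (ys ! m)" using False m(2) by (meson le_less_trans linorder_not_less order_trans)
  have "leftmost_argmax s (xs @ ys) = length xs + m"
  proof (rule leftmost_argmax_eqI)
    fix j
    show "s ((xs @ ys) ! j) \<le> s ((xs @ ys) ! (length xs + m))" if "j < length (xs @ ys)"
      using that gt assms(2)[of j] m(2)[of "j - length xs"] by (auto simp: nth_append)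
    show "s ((xs @ ys) ! j) < s ((xs @ ys) ! (length xs + m))" if "j < length xs + m"
      using that gt assms(2)[of j] m(3)[of "j - length xs"] by (auto simp: nth_append)
  qed (use m in auto)
  moreover have "leftmost_argmax s (xs ! i # ys) = Suc m"
    using m gt by (intro leftmost_argmax_eqI) (auto simp: nth_Cons split: nat.split)
  ultimately show ?thesis by simp
qed

section \<open>Answers of a-queries as minima of a key\<close>

lemma ex_sorted_enumeration:
  fixes key :: "'b \<Rightarrow> 'k::linorder"
  assumes "finite A"
  obtains \<tau> where "bij_betw \<tau> {1..card A} A"
    and "\<And>k l. 1 \<le> k \<Longrightarrow> k \<le> l \<Longrightarrow> l \<le> card A \<Longrightarrow> key (\<tau> k) \<le> key (\<tau> l)"
proof -
  obtain xs where xs: "set xs = A" "distinct xs" using finite_distinct_list[OF assms] by auto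
  define ys where "ys = sort_key key xs"
  have ys: "set ys = A" "distinct ys" "length ys = card A" "sorted (map key ys)"
    using xs distinct_card[of xs] by (auto simp: ys_def)
  have "bij_betw (\<lambda>k. k - 1) {1..card A} {..<card A}"
    by (rule bij_betw_byWitness[where f' = Suc]) auto
  moreover have "bij_betw ((!) ys) {..<card A} A" using ys bij_betw_nth by metis
  ultimately have "bij_betw (\<lambda>k. ys ! (k - 1)) {1..card A} A"
    using bij_betw_trans[of _ _ _ "(!) ys" A] by (simp add: comp_def)
  moreover have "key (ys ! (k - 1)) \<le> key (ys ! (l - 1))" if "1 \<le> k" "k \<le> l" "l \<le> card A" for k l
    using sorted_nth_mono[OF ys(4), of "k - 1" "l - 1"] that ys(3) by auto
  ultimately show thesis using that by blast
qed

text \<open>Every \<open>(j, w j)\<close> occurs in the enumeration, and not before the first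
  consistent position, so monotonicity bounds its key from below. The key is the pair of negated
  score and position when a decoder is unfolded, and the place in the permutation itself when a tree
  is simulated.\<close>

lemma a_query_least_key:
  fixes key :: "nat \<times> 'a \<Rightarrow> 'k::linorder"
  assumes n: "n \<ge> 1" and \<tau>: "is_permutation n \<Sigma> \<tau>" and w: "w \<in> words n \<Sigma>"
    and mono: "\<And>k l. 1 \<le> k \<Longrightarrow> k \<le> l \<Longrightarrow> l \<le> card (assignments n \<Sigma>) \<Longrightarrow> key (\<tau> k) \<le> key (\<tau> l)"
  obtains i where "i \<in> {1..n}" "a_query n \<Sigma> \<tau> w = (i, w i)"
    and "\<And>j. j \<in> {1..n} \<Longrightarrow> key (i, w i) \<le> key (j, w j)"
proof -
  let ?N = "card (assignments n \<Sigma>)"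
  let ?P = "\<lambda>k. k \<in> {1..?N} \<and> consistent (\<tau> k) w"
  define k where "k = (LEAST k. ?P k)"
  have ex: "\<exists>l. l \<in> {1..?N} \<and> \<tau> l = (j, w j)" if "j \<in> {1..n}" for j
  proof -
    have "(j, w j) \<in> assignments n \<Sigma>"
      using that w by (auto simp: assignments_def words_def)
    then show ?thesis using \<tau> unfolding is_permutation_def bij_betw_def by (metis imageE)
  qed
  have least: "k \<le> l" if "?P l" for l unfolding k_def using that by (rule Least_le)
  obtain l where "?P l" using ex[of 1] n by (force simp: consistent_def)
  then have k: "?P k" unfolding k_def by (rule LeastI)
  then have "\<tau> k \<in> assignments n \<Sigma>" using \<tau> unfolding is_permutation_def bij_betw_def by blast
  with k have i: "fst (\<tau> k) \<in> {1..n}" "\<tau> k = (fst (\<tau> k), w (fst (\<tau> k)))"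
    by (auto simp: assignments_def consistent_def)
  have "key (\<tau> k) \<le> key (j, w j)" if j: "j \<in> {1..n}" for j
  proof -
    obtain l where l: "l \<in> {1..?N}" "\<tau> l = (j, w j)" using ex[OF j] by blast
    then have "k \<le> l" by (intro least) (auto simp: consistent_def)
    then show ?thesis using mono[of k l] k l by auto
  qed
  moreover have "a_query n \<Sigma> \<tau> w = \<tau> k" by (simp add: a_query_def k_def)
  ultimately show thesis using that[of "fst (\<tau> k)"] i by metis
qed

section \<open>Unfolding a decoder run along the known tokens\<close>

lemma finite_assignments:
  assumes "\<And>i. i \<in> {1..n} \<Longrightarrow> finite (\<Sigma> i)"
  shows "finite (assignments n \<Sigma>)"
  using assms by (auto simp: assignments_def)

text \<open>The recursion reads all earlier states. Carrying the whole token sequence turns it into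
  the iteration of one map, so that an induction on \<open>t\<close> can peel off the first step and
  start again from a longer sequence.\<close>

lemma decoder_state_eq_funpow:
  "xs @ map (decoder_state L xs y0) [0..<Suc t] = ((\<lambda>zs. zs @ [L zs]) ^^ t) (xs @ [y0])"
proof (induction t)
  case (Suc t)
  have "xs @ map (decoder_state L xs y0) [0..<Suc (Suc t)]
    = (\<lambda>zs. zs @ [L zs]) (xs @ map (decoder_state L xs y0) [0..<Suc t])" by simp
  then show ?case using Suc by simp
qed simp

lemma decoder_state_eq_last:
  "decoder_state L xs y0 t = last (((\<lambda>zs. zs @ [L zs]) ^^ t) (xs @ [y0]))"
  unfolding decoder_state_eq_funpow[symmetric] by simp

text \<open>With \<open>ys\<close> known, sorting the assignments by decreasing score (ties by position) yields an
  a-query whose answer already determines the output of the head.\<close>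

lemma attention_head_eq_a_query:
  assumes n: "n \<ge> 1" and fin: "finite (assignments n \<Sigma>)" and ys: "ys \<noteq> []"
  obtains \<tau> where "is_permutation n \<Sigma> \<tau>"
    and "\<And>w. w \<in> words n \<Sigma> \<Longrightarrow> 
      attention_head Q K (map (\<lambda>i. p (i, w i)) [1..<Suc n] @ ys)
      = attention_head Q K (p (a_query n \<Sigma> \<tau> w) # ys)"
proof -
  define s where "s = (\<lambda>x. (K *\<^sub>v x) \<bullet> (Q *\<^sub>v last (ys)))"
  define key where "key = (\<lambda>a. (- s (p a), fst a))"
  obtain \<tau> where \<tau>: "is_permutation n \<Sigma> \<tau>"
    and mono: "\<And>k l. 1 \<le> k \<Longrightarrow> k \<le> l \<Longrightarrow> l \<le> card (assignments n \<Sigma>) \<Longrightarrow> key (\<tau> k) \<le> key (\<tau> l)"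
    unfolding is_permutation_def by (rule ex_sorted_enumeration[OF fin, of key]) blast
  have "attention_head Q K (map (\<lambda>i. p (i, w i)) [1..<Suc n] @ ys)
      = attention_head Q K (p (a_query n \<Sigma> \<tau> w) # ys)" if w: "w \<in> words n \<Sigma>" for w
  proof -
    let ?xs = "map (\<lambda>i. p (i, w i)) [1..<Suc n]"
    obtain i where i: "i \<in> {1..n}" "a_query n \<Sigma> \<tau> w = (i, w i)"
      and key_le: "\<And>j. j \<in> {1..n} \<Longrightarrow> key (i, w i) \<le> key (j, w j)"
      by (rule a_query_least_key[where key = key, OF n \<tau> w mono]) blast+
    have le: "(- s (p (i, w i)), i) \<le> (- s (p (j, w j)), j)" if "j \<in> {1..n}" for j
      using key_le[OF that] by (simp add: key_def)
    have nth: "?xs ! j = p (Suc j, w (Suc j))" if "j < n" for j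
      using that by (simp del: upt_Suc)
    have "(?xs @ ys) ! leftmost_argmax s (?xs @ ys)
      = (?xs ! (i - 1) # ys) ! leftmost_argmax s (?xs ! (i - 1) # ys)"
    proof (rule nth_leftmost_argmax_append)
      fix j
      show "s (?xs ! j) \<le> s (?xs ! (i - 1))" if "j < length ?xs"
        using le[of "Suc j"] that i nth[of j] nth[of "i - 1"] by auto
      show "s (?xs ! j) < s (?xs ! (i - 1))" if "j < i - 1"
      proof -
        \<comment> \<open>Equal scores would force \<open>i \<le> Suc j\<close> in the second
          component, so the scores differ strictly.\<close>
        have "Suc j \<in> {1..n}" "\<not> i \<le> Suc j" using that i by auto
        then show ?thesis using le[of "Suc j"] i nth[of j] nth[of "i - 1"] by auto
      qed
    qed (use i in auto)
    also have "?xs ! (i - 1) = p (a_query n \<Sigma> \<tau> w)" using i nth[of "i - 1"] by auto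
    finally show ?thesis unfolding attention_head_def using ys by (simp add: s_def del: upt_Suc)
  qed
  then show thesis using that \<tau> by blast
qed

text \<open>The induction needs an arbitrary known suffix \<open>ys\<close> in place of the single
  start token: the answers at a node determine the next token, which is then appended to
  \<open>ys\<close> and known throughout the child.\<close>

lemma decoder_imp_dtree:
  fixes \<Sigma> :: "nat \<Rightarrow> 'a set" and Out :: "'o set" and ys :: "real vec list"
  assumes n: "n \<ge> 1" and fin: "\<And>i. i \<in> {1..n} \<Longrightarrow> finite (\<Sigma> i) \<and> \<Sigma> i \<noteq> {}"
    and L: "is_attention_layer H d L"
    and p: "\<And>a. a \<in> assignments n \<Sigma> \<Longrightarrow> p a \<in> carrier_vec d"
    and \<alpha>: "\<alpha> \<in> carrier_vec d \<rightarrow> Out"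
    and ys: "ys \<noteq> []" "set ys \<subseteq> carrier_vec d"
  shows "\<exists>T. is_dtree_over (words n \<Sigma>) (a_queries H n \<Sigma>) Out T \<and> dtree_depth (words n \<Sigma>) T \<le> t \<and>
    (\<forall>w\<in>words n \<Sigma>. dtree_output T w =
       \<alpha> (last (((\<lambda>zs. zs @ [L zs]) ^^ t) (map (\<lambda>i. p (i, w i)) [1..<Suc n] @ ys))))"
  using ys
proof (induction t arbitrary: ys)
  case 0
  then have "\<alpha> (last ys) \<in> Out" using \<alpha> by (auto dest!: last_in_set)
  then show ?case using 0 by (intro exI[of _ "Leaf (\<alpha> (last ys))"]) auto
next
  case (Suc t)
  let ?D = "words n \<Sigma>" and ?xs = "\<lambda>w. map (\<lambda>i. p (i, w i)) [1..<Suc n]"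
  have finA: "finite (assignments n \<Sigma>)" using fin by (intro finite_assignments) auto
  have finD: "finite ?D" "?D \<noteq> {}"
    using fin by (auto simp: words_def PiE_eq_empty_iff intro!: finite_PiE)
  from L obtain Q K W1 W2 WO where W2: "W2 \<in> carrier_mat d d"
    and L_eq: "\<And>xs. xs \<noteq> [] \<Longrightarrow> set xs \<subseteq> carrier_vec d \<Longrightarrow> L xs = layer_output H Q K W1 W2 WO xs"
    unfolding is_attention_layer_def by auto
  have "\<exists>\<tau>. is_permutation n \<Sigma> \<tau> \<and> (\<forall>w\<in>?D.
      attention_head (Q h) (K h) (?xs w @ ys) = attention_head (Q h) (K h) (p (a_query n \<Sigma> \<tau> w) # ys))"
    for h
  proof -
    obtain \<tau> where "is_permutation n \<Sigma> \<tau>" "\<And>w. w \<in> ?D \<Longrightarrow>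
      attention_head (Q h) (K h) (?xs w @ ys) = attention_head (Q h) (K h) (p (a_query n \<Sigma> \<tau> w) # ys)"
      using attention_head_eq_a_query[OF n finA Suc.prems(1), of "Q h" "K h" p] by metis
    then show ?thesis by (intro exI conjI ballI)
  qed
  then obtain \<tau> where \<tau>: "\<And>h. is_permutation n \<Sigma> (\<tau> h)"
    and head: "\<And>h w. w \<in> ?D \<Longrightarrow> attention_head (Q h) (K h) (?xs w @ ys)
      = attention_head (Q h) (K h) (p (a_query n \<Sigma> (\<tau> h) w) # ys)"
    by metis
  define q where "q = (\<lambda>w. map (\<lambda>t. a_query n \<Sigma> t w) (map \<tau> [1..<Suc H]))"
  define nxt where "nxt = (\<lambda>r. W2 *\<^sub>v relu (W1 *\<^sub>v (WO *\<^sub>v concat_vecs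
    (map (\<lambda>h. attention_head (Q h) (K h) (p (r ! (h - 1)) # ys)) [1..<Suc H]) + last ys)))"
  \<comment> \<open>The dimension comes from \<open>W2\<close> alone, so this covers lists
    \<open>r\<close> that no word produces, and a child can be chosen for every label.\<close>
  have nxt_carrier: "nxt r \<in> carrier_vec d" for r
    using W2 by (intro carrier_vecI) (simp add: nxt_def del: upt_Suc)
  have "\<exists>T. is_dtree_over ?D (a_queries H n \<Sigma>) Out T \<and> dtree_depth ?D T \<le> t \<and>
    (\<forall>w\<in>?D. dtree_output T w = \<alpha> (last (((\<lambda>zs. zs @ [L zs]) ^^ t) (?xs w @ ys @ [nxt r]))))" for r
    by (rule Suc.IH) (use Suc.prems nxt_carrier in simp_all)
  then obtain ch where ch: "\<And>r. is_dtree_over ?D (a_queries H n \<Sigma>) Out (ch r)"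
    "\<And>r. dtree_depth ?D (ch r) \<le> t"
    "\<And>r w. w \<in> ?D \<Longrightarrow> dtree_output (ch r) w
      = \<alpha> (last (((\<lambda>zs. zs @ [L zs]) ^^ t) (?xs w @ ys @ [nxt r])))"
    using choice[of "\<lambda>r T. is_dtree_over ?D (a_queries H n \<Sigma>) Out T \<and> dtree_depth ?D T \<le> t \<and>
      (\<forall>w\<in>?D. dtree_output T w = \<alpha> (last (((\<lambda>zs. zs @ [L zs]) ^^ t) (?xs w @ ys @ [nxt r]))))"]
    by blast
  have "L (?xs w @ ys) = nxt (q w)" if w: "w \<in> ?D" for w
  proof -
    have "set (?xs w) \<subseteq> carrier_vec d"
      using w by (auto intro!: p simp: assignments_def words_def)
    then have "L (?xs w @ ys) = layer_output H Q K W1 W2 WO (?xs w @ ys)"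
      using Suc.prems by (intro L_eq) auto
    moreover have "map (\<lambda>h. attention_head (Q h) (K h) (?xs w @ ys)) [1..<Suc H]
      = map (\<lambda>h. attention_head (Q h) (K h) (p (q w ! (h - 1)) # ys)) [1..<Suc H]"
      by (rule map_cong) (auto simp: head[OF w, unfolded One_nat_def] q_def simp del: upt_Suc)
    moreover have "last (?xs w @ ys) = last ys" using Suc.prems(1) by (rule last_appendR)
    ultimately show ?thesis by (simp only: layer_output_def nxt_def Let_def)
  qed
  then have "dtree_output (ch (q w)) w
    = \<alpha> (last (((\<lambda>zs. zs @ [L zs]) ^^ Suc t) (?xs w @ ys)))" if "w \<in> ?D" for w
    using that ch(3)[OF that] by (simp add: funpow_Suc_right del: upt_Suc funpow.simps(2))
  moreover have "q \<in> a_queries H n \<Sigma>"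
    unfolding a_queries_def q_def
    by (intro CollectI exI[of _ "map \<tau> [1..<Suc H]"]) (use \<tau> in \<open>auto simp del: upt_Suc\<close>)
  moreover have "Max ((\<lambda>r. dtree_depth ?D (ch r)) ` q ` ?D) \<le> t"
    using finD ch(2) by auto
  ultimately show ?case using ch(1) by (intro exI[of _ "Node q ch"]) auto
qed

section \<open>One-hot linear algebra\<close>

text \<open>The coordinates of vectors are relabelled along a bijection \<open>\<iota>\<close> from \<open>{..<d}\<close> to an index set,
  and \<open>0/1\<close>-vectors are identified with subsets of that index set.\<close>

definition ind :: "(nat \<Rightarrow> 'i) \<Rightarrow> nat \<Rightarrow> 'i set \<Rightarrow> real vec" where
  "ind \<iota> d X = vec d (\<lambda>k. of_bool (\<iota> k \<in> X))"

definition coord_mat :: "nat \<Rightarrow> (nat \<Rightarrow> 'j) \<Rightarrow> nat \<Rightarrow> (nat \<Rightarrow> 'i) \<Rightarrow> ('j \<Rightarrow> 'i \<Rightarrow> real) \<Rightarrow> real mat" where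
  "coord_mat e \<kappa> d \<iota> M = mat e d (\<lambda>(k, l). M (\<kappa> k) (\<iota> l))"

lemma ind_carrier [simp]: "ind \<iota> d X \<in> carrier_vec d" "dim_vec (ind \<iota> d X) = d"
  by (auto simp: ind_def)

lemma coord_mat_carrier [simp]: "coord_mat e \<kappa> d \<iota> M \<in> carrier_mat e d"
  by (auto simp: coord_mat_def)

lemma ind_scalar_prod:
  assumes \<iota>: "bij_betw \<iota> {..<d} I" and X: "X \<subseteq> I"
  shows "ind \<iota> d X \<bullet> vec d (\<lambda>k. g (\<iota> k)) = sum g X"
proof -
  have fin: "finite I" using bij_betw_finite[OF \<iota>] by simp
  have "ind \<iota> d X \<bullet> vec d (\<lambda>k. g (\<iota> k)) = (\<Sum>k<d. of_bool (\<iota> k \<in> X) * g (\<iota> k))"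
    by (simp add: scalar_prod_def ind_def atLeast0LessThan)
  also have "\<dots> = (\<Sum>i\<in>I. of_bool (i \<in> X) * g i)"
    using sum.reindex_bij_betw[OF \<iota>, of "\<lambda>i. of_bool (i \<in> X) * g i"] by simp
  also have "\<dots> = sum g X"
    using X fin by (intro sum.mono_neutral_cong_right) auto
  finally show ?thesis .
qed

lemma coord_mat_mult_ind:
  assumes "bij_betw \<iota> {..<d} I" "X \<subseteq> I"
  shows "coord_mat e \<kappa> d \<iota> M *\<^sub>v ind \<iota> d X = vec e (\<lambda>k. sum (M (\<kappa> k)) X)"
proof (rule eq_vecI)
  fix k assume "k < dim_vec (vec e (\<lambda>k. sum (M (\<kappa> k)) X))"
  then have k: "k < e" by simp
  then have "row (coord_mat e \<kappa> d \<iota> M) k = vec d (\<lambda>l. M (\<kappa> k) (\<iota> l))"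
    by (auto simp: coord_mat_def)
  then show "(coord_mat e \<kappa> d \<iota> M *\<^sub>v ind \<iota> d X) $ k = vec e (\<lambda>k. sum (M (\<kappa> k)) X) $ k"
    using k ind_scalar_prod[OF assms, of "M (\<kappa> k)"]
    by (simp add: coord_mat_def comm_scalar_prod[of _ d])
qed (simp add: coord_mat_def)

lemma coord_mat_mult_ind_eq_ind:
  assumes "bij_betw \<iota> {..<d} I" "X \<subseteq> I" and \<kappa>: "bij_betw \<kappa> {..<e} J"
    and "\<And>j. j \<in> J \<Longrightarrow> sum (M j) X = of_bool (j \<in> Y)"
  shows "coord_mat e \<kappa> d \<iota> M *\<^sub>v ind \<iota> d X = ind \<kappa> e Y"
  unfolding coord_mat_mult_ind[OF assms(1,2)] using assms(4) bij_betwE[OF \<kappa>]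
  by (intro eq_vecI) (simp_all add: ind_def)

lemma relu_coord_mat_mult_ind_eq_ind:
  assumes "bij_betw \<iota> {..<d} I" "X \<subseteq> I" and \<kappa>: "bij_betw \<kappa> {..<e} J"
    and "\<And>j. j \<in> J \<Longrightarrow> max 0 (sum (M j) X) = of_bool (j \<in> Y)"
  shows "relu (coord_mat e \<kappa> d \<iota> M *\<^sub>v ind \<iota> d X) = ind \<kappa> e Y"
  unfolding coord_mat_mult_ind[OF assms(1,2)] relu_def using assms(4) bij_betwE[OF \<kappa>]
  by (intro eq_vecI) (simp_all add: ind_def)

lemma concat_vecs_nth:
  assumes "\<And>v. v \<in> set vs \<Longrightarrow> dim_vec v = d"
  shows "dim_vec (concat_vecs vs) = d * length vs"
    and "j < d * length vs \<Longrightarrow> concat_vecs vs $ j = vs ! (j div d) $ (j mod d)"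
proof -
  have "dim_vec (concat_vecs vs) = d * length vs \<and>
    (\<forall>j<d * length vs. concat_vecs vs $ j = vs ! (j div d) $ (j mod d))"
    using assms
  proof (induction vs)
    case (Cons v vs)
    have IH: "dim_vec (concat_vecs vs) = d * length vs"
      "\<And>j. j < d * length vs \<Longrightarrow> concat_vecs vs $ j = vs ! (j div d) $ (j mod d)"
      and v: "dim_vec v = d"
      using Cons by auto
    have c: "concat_vecs (v # vs) = v @\<^sub>v concat_vecs vs" by (simp add: concat_vecs_def)
    have "concat_vecs (v # vs) $ j = (v # vs) ! (j div d) $ (j mod d)"
      if j: "j < d * length (v # vs)" for j
    proof (cases "j < d")
      case False
      have "0 < d" using j by (cases "d = 0") auto
      then have "j div d = Suc ((j - d) div d)" "j mod d = (j - d) mod d"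
        using False by (auto simp: le_div_geq le_mod_geq)
      then show ?thesis using False j IH v by (simp add: c)
    qed (use v IH in \<open>simp add: c\<close>)
    then show ?case using IH v by (simp add: c)
  qed (auto simp: concat_vecs_def)
  then show "dim_vec (concat_vecs vs) = d * length vs"
    and "j < d * length vs \<Longrightarrow> concat_vecs vs $ j = vs ! (j div d) $ (j mod d)" by auto
qed

text \<open>Coordinate \<open>j\<close> of the concatenation is coordinate \<open>j mod d\<close> of
  block \<open>j div d\<close>. Relabelled by such pairs, concatenated 0/1-vectors form the
  0/1-vector of a disjoint union, on which \<open>WO\<close> can again be given by named
  coordinates.\<close>

lemma concat_vecs_ind:
  "concat_vecs (map (\<lambda>h. ind \<iota> d (X h)) [0..<H])
    = ind (\<lambda>j. (j div d, \<iota> (j mod d))) (d * H) (Sigma {..<H} X)"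
proof -
  let ?vs = "map (\<lambda>h. ind \<iota> d (X h)) [0..<H]"
  have dim: "dim_vec v = d" if "v \<in> set ?vs" for v using that by auto
  show ?thesis
  proof (rule eq_vecI)
    fix j assume "j < dim_vec (ind (\<lambda>j. (j div d, \<iota> (j mod d))) (d * H) (Sigma {..<H} X))"
    then have j: "j < d * H" by simp
    then have "j div d < H" "j mod d < d"
      by (auto simp: less_mult_imp_div_less mult.commute intro!: mod_less_divisor gr0I)
    then show "concat_vecs ?vs $ j = ind (\<lambda>j. (j div d, \<iota> (j mod d))) (d * H) (Sigma {..<H} X) $ j"
      using concat_vecs_nth(2)[OF dim, where vs = ?vs and j = j] j by (simp add: ind_def)
  qed (use concat_vecs_nth(1)[OF dim, where vs = ?vs] in simp)
qed

lemma bij_betw_div_mod: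
  fixes d H :: nat
  assumes "bij_betw \<iota> {..<d} I"
  shows "bij_betw (\<lambda>j. (j div d, \<iota> (j mod d))) {..<d * H} ({..<H} \<times> I)"
proof -
  have "bij_betw (\<lambda>j. (j div d, j mod d)) {..<d * H} ({..<H} \<times> {..<d})"
  proof (rule bij_betw_byWitness[where f' = "\<lambda>(h, k). h * d + k"])
    have "h * d + k < d * H" if "h < H" "k < d" for h k
    proof -
      have "h * d + k < Suc h * d" using that by simp
      also have "\<dots> \<le> H * d" using that by (intro mult_le_mono1) auto
      finally show ?thesis by (simp add: mult.commute)
    qed
    then show "(\<lambda>(h, k). h * d + k) ` ({..<H} \<times> {..<d}) \<subseteq> {..<d * H}" by auto
  qed (auto simp: less_mult_imp_div_less mult.commute intro!: mod_less_divisor gr0I)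
  moreover have "bij_betw (map_prod id \<iota>) ({..<H} \<times> {..<d}) ({..<H} \<times> I)"
    using assms by (intro bij_betw_map_prod) auto
  ultimately show ?thesis
    using bij_betw_trans by (fastforce simp: comp_def)
qed

text \<open>The argument of the maximum is an integer that is at most 1. It equals 1 only if
  \<open>b\<close> holds and all \<open>H\<close> positions agree; a single failure brings it down
  to 0 or below, where it is clipped.\<close>

lemma relu_unit_eq:
  fixes b :: bool
  assumes "length r = H"
  shows "max 0 (of_bool b - real H + (\<Sum>h<H. of_bool (r ! h = a h)))
    = of_bool (b \<and> r = map a [0..<H])"
proof (cases "r = map a [0..<H]")
  case True
  then show ?thesis by simp
next
  case False
  then obtain h where h: "h < H" "r ! h \<noteq> a h"
    using assms by (metis add_0 diff_zero length_map length_upt nth_equalityI nth_map nth_upt)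
  have "(\<Sum>h<H. of_bool (r ! h = a h)) < (\<Sum>h<H. 1 :: nat)"
    using h by (intro sum_strict_mono_ex1) auto
  then have "real (\<Sum>h<H. of_bool (r ! h = a h)) \<le> real H - 1" by simp
  then have "(\<Sum>h<H. of_bool (r ! h = a h)) \<le> real H - 1" by (simp del: sum_of_bool_eq)
  then show ?thesis using False by (cases b) (auto simp del: sum_of_bool_eq)
qed

datatype ('s, 'b) coord = St 's | Asg 'b | Slot nat 'b | Unit 's "'b list"

section \<open>From decision trees to decoders\<close>

text \<open>A finite automaton that in state \<open>v\<close> asks the a-queries \<open>\<tau> v 0, \<dots>, \<tau> v (H - 1)\<close> and moves
  to \<open>\<delta> v r\<close> on the answers \<open>r\<close> is simulated by a decoder: the embedding of the last token is the
  unit vector \<open>St v\<close>, head \<open>h\<close> writes its answer \<open>a\<close> to \<open>Slot h a\<close>, and the ReLU unit \<open>Unit v r\<close>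
  fires exactly if the state is \<open>v\<close> and the answers are \<open>r\<close>.\<close>

locale query_automaton =
  fixes H n :: nat and \<Sigma> :: "nat \<Rightarrow> 'a set" and S :: "'s set"
    and \<tau> :: "'s \<Rightarrow> nat \<Rightarrow> nat \<Rightarrow> nat \<times> 'a" and \<delta> :: "'s \<Rightarrow> (nat \<times> 'a) list \<Rightarrow> 's"
  assumes n_pos: "n \<ge> 1" and finite_A: "finite (assignments n \<Sigma>)" and finite_S: "finite S"
    and perm: "v \<in> S \<Longrightarrow> h < H \<Longrightarrow> is_permutation n \<Sigma> (\<tau> v h)"
begin

abbreviation answers :: "'s \<Rightarrow> (nat \<Rightarrow> 'a) \<Rightarrow> (nat \<times> 'a) list" where
  "answers v w \<equiv> map (\<lambda>h. a_query n \<Sigma> (\<tau> v h) w) [0..<H]"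

definition coords :: "('s, nat \<times> 'a) coord set" where
  "coords = St ` S \<union> Asg ` assignments n \<Sigma> \<union> (\<Union>h<H. Slot h ` assignments n \<Sigma>)
     \<union> (\<Union>v\<in>S. Unit v ` {r. set r \<subseteq> assignments n \<Sigma> \<and> length r = H})"

definition d :: nat where "d = card coords"

definition \<iota> :: "nat \<Rightarrow> ('s, nat \<times> 'a) coord" where
  "\<iota> = (SOME \<iota>. bij_betw \<iota> {..<d} coords)"

lemma bij_\<iota>: "bij_betw \<iota> {..<d} coords"
proof -
  have "finite coords"
    unfolding coords_def using finite_A finite_S by (auto intro!: finite_lists_length_eq)
  then show ?thesis
    unfolding \<iota>_def d_def using ex_bij_betw_nat_finite[of coords]
    by (metis atLeast0LessThan someI_ex)
qed

abbreviation e :: "('s, nat \<times> 'a) coord set \<Rightarrow> real vec" where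
  "e X \<equiv> ind \<iota> d X"

abbreviation block :: "nat \<Rightarrow> nat \<times> ('s, nat \<times> 'a) coord" where
  "block j \<equiv> (j div d, \<iota> (j mod d))"

text \<open>All scores of assignments are positive, so that the heads never select one of the generated
  tokens, whose score is \<open>0\<close>.\<close>

definition score :: "'s \<Rightarrow> nat \<Rightarrow> nat \<times> 'a \<Rightarrow> real" where
  "score v h a = inverse (real (inv_into {1..card (assignments n \<Sigma>)} (\<tau> v h) a))"

text \<open>The key matrix will be the identity, so a token is scored by its scalar product with
  this matrix applied to the last token. The shift \<open>h - 1\<close> translates the layer's head
  numbers, which start at 1, into those of the automaton, which start at 0.\<close>

definition Qm :: "nat \<Rightarrow> real mat" where
  "Qm h = coord_mat d \<iota> d \<iota>
     (\<lambda>i j. case (i, j) of (Asg a, St v) \<Rightarrow> score v (h - 1) a | _ \<Rightarrow> 0)"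

definition WO :: "real mat" where
  "WO = coord_mat d \<iota> (d * H) block
     (\<lambda>i (h', j). case (i, j) of (Slot h a, Asg b) \<Rightarrow> of_bool (h = h' \<and> a = b) | _ \<Rightarrow> 0)"

text \<open>The layer has no bias vector. As exactly one \<open>St\<close> coordinate of its
  argument is 1, the \<open>St\<close> columns can carry the threshold
  \<open>- real H\<close>.\<close>

definition W1 :: "real mat" where
  "W1 = coord_mat d \<iota> d \<iota>
     (\<lambda>i j. case i of Unit v r \<Rightarrow>
        (case j of St u \<Rightarrow> of_bool (u = v) - real H | Slot h a \<Rightarrow> of_bool (r ! h = a) | _ \<Rightarrow> 0)
      | _ \<Rightarrow> 0)"

definition W2 :: "real mat" where
  "W2 = coord_mat d \<iota> d \<iota>
     (\<lambda>i j. case (i, j) of (St u, Unit v r) \<Rightarrow> of_bool (u = \<delta> v r) | _ \<Rightarrow> 0)"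

text \<open>Distinct assignments have distinct places in the permutation, so their scores never tie;
  the reciprocal makes the earliest one the largest.\<close>

lemma a_query_maximal_score:
  assumes "v \<in> S" "h < H" "w \<in> words n \<Sigma>"
  obtains i where "i \<in> {1..n}" "a_query n \<Sigma> (\<tau> v h) w = (i, w i)"
    and "\<And>j. j \<in> {1..n} \<Longrightarrow> j \<noteq> i \<Longrightarrow> score v h (j, w j) < score v h (i, w i)"
proof -
  let ?N = "{1..card (assignments n \<Sigma>)}"
  let ?key = "inv_into ?N (\<tau> v h)"
  note \<tau> = perm[OF assms(1,2)]
  have bij: "bij_betw (\<tau> v h) ?N (assignments n \<Sigma>)" using \<tau> by (simp add: is_permutation_def)
  have "?key (\<tau> v h k) \<le> ?key (\<tau> v h l)" if "1 \<le> k" "k \<le> l" "l \<le> card (assignments n \<Sigma>)" for k l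
    using that bij by (simp add: bij_betw_def inv_into_f_f)
  then obtain i where i: "i \<in> {1..n}" "a_query n \<Sigma> (\<tau> v h) w = (i, w i)"
    and le: "\<And>j. j \<in> {1..n} \<Longrightarrow> ?key (i, w i) \<le> ?key (j, w j)"
    by (rule a_query_least_key[where key = ?key, OF n_pos \<tau> assms(3)]) blast+
  have key_bij: "bij_betw ?key (assignments n \<Sigma>) ?N" by (rule bij_betw_inv_into[OF bij])
  have asg: "(j, w j) \<in> assignments n \<Sigma>" if "j \<in> {1..n}" for j
    using that assms(3) by (auto simp: assignments_def words_def)
  have "score v h (j, w j) < score v h (i, w i)" if j: "j \<in> {1..n}" "j \<noteq> i" for j
  proof -
    have "?key (i, w i) \<noteq> ?key (j, w j)"
      using key_bij asg[OF j(1)] asg[OF i(1)] j(2) unfolding bij_betw_def by (auto dest: inj_onD)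
    moreover have "?key (i, w i) \<ge> 1"
      using key_bij asg[OF i(1)] by (auto simp: bij_betw_def)
    ultimately show ?thesis
      using le[OF j(1)] by (simp add: score_def)
  qed
  then show thesis using that i by blast
qed

text \<open>Only the last token enters the query vector. The earlier states are merely further
  candidates of score 0, so the head answers for the current state.\<close>

lemma head_eq:
  assumes v: "set vs \<subseteq> S" "vs \<noteq> []" and h: "h < H" and w: "w \<in> words n \<Sigma>"
  shows "attention_head (Qm (Suc h)) (1\<^sub>m d)
    (map (\<lambda>i. e {Asg (i, w i)}) [1..<Suc n] @ map (\<lambda>v. e {St v}) vs)
    = e {Asg (a_query n \<Sigma> (\<tau> (last vs) h) w)}"
proof -
  let ?v = "last vs"
  let ?xs = "map (\<lambda>i. e {Asg (i, w i)}) [1..<Suc n]" and ?ys = "map (\<lambda>v. e {St v}) vs"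
  let ?s = "\<lambda>x. (1\<^sub>m d *\<^sub>v x) \<bullet> (Qm (Suc h) *\<^sub>v last (?xs @ ?ys))"
  have v': "?v \<in> S" using v by auto
  obtain i where i: "i \<in> {1..n}" "a_query n \<Sigma> (\<tau> ?v h) w = (i, w i)"
    and less: "\<And>j. j \<in> {1..n} \<Longrightarrow> j \<noteq> i \<Longrightarrow> score ?v h (j, w j) < score ?v h (i, w i)"
    using a_query_maximal_score[OF v' h w] by blast
  define g where "g = (\<lambda>c :: ('s, nat \<times> 'a) coord. case c of Asg a \<Rightarrow> score ?v h a | _ \<Rightarrow> 0)"
  have "Qm (Suc h) *\<^sub>v last (?xs @ ?ys) = vec d (\<lambda>k. g (\<iota> k))"
    using v v' by (simp add: last_map Qm_def g_def coords_def coord_mat_mult_ind[OF bij_\<iota>] cong: coord.case_cong)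
  then have s: "?s (e {c}) = g c" if "c \<in> coords" for c
    using ind_scalar_prod[OF bij_\<iota>, of "{c}" g] that by simp
  have asg: "Asg (j, w j) \<in> coords" if "j \<in> {1..n}" for j
    using that w by (auto simp: coords_def assignments_def words_def)
  have nth: "?xs ! j = e {Asg (Suc j, w (Suc j))}" if "j < n" for j
    using that by (simp del: upt_Suc)
  have sx: "?s (?xs ! j) = score ?v h (Suc j, w (Suc j))" if "j < n" for j
    unfolding nth[OF that] using that by (subst s[OF asg]) (auto simp: g_def)
  have sy: "?s (?ys ! j) = 0" if "j < length vs" for j
  proof -
    have "St (vs ! j) \<in> coords" using that v nth_mem by (fastforce simp: coords_def)
    then show ?thesis using that s[of "St (vs ! j)"] by (simp add: g_def)
  qed
  have si: "?s (?xs ! (i - 1)) = score ?v h (i, w i)" using sx[of "i - 1"] i by auto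
  have len: "length ?xs = n" by simp
  have "leftmost_argmax ?s (?xs @ ?ys) = i - 1"
  proof (rule leftmost_argmax_eqI)
    fix j
    have "i - 1 < n" using i by auto
    then have nn: "(?xs @ ?ys) ! (i - 1) = ?xs ! (i - 1)" using len by (simp add: nth_append del: upt_Suc)
    show "?s ((?xs @ ?ys) ! j) \<le> ?s ((?xs @ ?ys) ! (i - 1))" if "j < length (?xs @ ?ys)"
    proof (cases "j < n")
      case True
      then have "?s ((?xs @ ?ys) ! j) = score ?v h (Suc j, w (Suc j))"
        using sx[OF True] len by (simp add: nth_append del: upt_Suc)
      then show ?thesis unfolding nn si using less[of "Suc j"] True by (cases "Suc j = i") auto
    next
      case False
      \<comment> \<open>The generated tokens stand to the right of the input, so a weak inequality
        suffices for them.\<close>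
      then have "?s ((?xs @ ?ys) ! j) = 0"
        using sy[of "j - n"] that len by (simp add: nth_append del: upt_Suc)
      then show ?thesis unfolding nn si by (simp add: score_def)
    qed
    show "?s ((?xs @ ?ys) ! j) < ?s ((?xs @ ?ys) ! (i - 1))" if "j < i - 1"
    proof -
      have j: "j < n" "Suc j \<noteq> i" using that i by auto
      then have "?s ((?xs @ ?ys) ! j) = score ?v h (Suc j, w (Suc j))"
        using sx[OF j(1)] len by (simp add: nth_append del: upt_Suc)
      then show ?thesis unfolding nn si using less[of "Suc j"] j by auto
    qed
  qed (use i in auto)
  then show ?thesis
    unfolding attention_head_def using i len nth[of "i - 1"] by (auto simp: nth_append simp del: upt_Suc)
qed

text \<open>Every stage yields a 0/1-vector: the heads give one \<open>Asg\<close> per block,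
  \<open>WO\<close> turns these into one \<open>Slot\<close> per head, the residual adds the state,
  the ReLU leaves a single \<open>Unit\<close>, and \<open>W2\<close> translates it into the next
  state.\<close>

lemma layer_output_eq:
  assumes v: "set vs \<subseteq> S" "vs \<noteq> []" and w: "w \<in> words n \<Sigma>"
  shows "layer_output H Qm (\<lambda>_. 1\<^sub>m d) W1 W2 WO
    (map (\<lambda>i. e {Asg (i, w i)}) [1..<Suc n] @ map (\<lambda>v. e {St v}) vs)
    = e {St (\<delta> (last vs) (answers (last vs) w))}"
proof -
  define v where "v = last vs"
  define a where "a = (\<lambda>h. a_query n \<Sigma> (\<tau> v h) w)"
  let ?zs = "map (\<lambda>i. e {Asg (i, w i)}) [1..<Suc n] @ map (\<lambda>v. e {St v}) vs"
  let ?slots = "(\<lambda>h. Slot h (a h)) ` {..<H}"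
  have vS: "v \<in> S" using v by (auto simp: v_def)
  have a: "a h \<in> assignments n \<Sigma>" if h: "h < H" for h
  proof -
    obtain i where "i \<in> {1..n}" "a h = (i, w i)"
      using a_query_maximal_score[OF vS h w] unfolding a_def by blast
    then show ?thesis using w by (auto simp: assignments_def words_def)
  qed
  have "map (\<lambda>h. attention_head (Qm h) (1\<^sub>m d) ?zs) [1..<Suc H]
    = map (\<lambda>h. attention_head (Qm (Suc h)) (1\<^sub>m d) ?zs) [0..<H]"
    unfolding One_nat_def map_Suc_upt[symmetric] map_map comp_def by (rule refl)
  also have "\<dots> = map (\<lambda>h. e {Asg (a h)}) [0..<H]"
    using head_eq[OF assms(1,2) _ w] by (intro map_cong) (auto simp: a_def v_def simp del: upt_Suc)
  finally have "concat_vecs (map (\<lambda>h. attention_head (Qm h) (1\<^sub>m d) ?zs) [1..<Suc H])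
    = ind block (d * H) (SIGMA h:{..<H}. {Asg (a h)})"
    by (simp only: concat_vecs_ind)
  also have "(SIGMA h:{..<H}. {Asg (a h)}) = (\<lambda>h. (h, Asg (a h))) ` {..<H}" by auto
  finally have "concat_vecs (map (\<lambda>h. attention_head (Qm h) (1\<^sub>m d) ?zs) [1..<Suc H])
    = ind block (d * H) ((\<lambda>h. (h, Asg (a h))) ` {..<H})" .
  moreover have "WO *\<^sub>v ind block (d * H) ((\<lambda>h. (h, Asg (a h))) ` {..<H}) = e ?slots"
  proof -
    have sub: "(\<lambda>h. (h, Asg (a h))) ` {..<H} \<subseteq> {..<H} \<times> coords" using a by (auto simp: coords_def)
    have inj: "inj_on (\<lambda>h. (h, Asg (a h))) {..<H}" by (auto intro: inj_onI)
    have sum: "(\<Sum>h'<H. of_bool (h = h' \<and> b = a h')) = (of_bool (h < H \<and> b = a h) :: real)" for h b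
    proof -
      have "(\<Sum>h'<H. of_bool (h = h' \<and> b = a h')) = (\<Sum>h'<H. if h' = h then of_bool (b = a h) else 0 :: real)"
        by (intro sum.cong) auto
      then show ?thesis by simp
    qed
    show ?thesis
      unfolding WO_def
    proof (rule coord_mat_mult_ind_eq_ind[OF bij_betw_div_mod[OF bij_\<iota>] sub bij_\<iota>], unfold sum.reindex[OF inj])
      fix i :: "('s, nat \<times> 'a) coord"
      show "sum ((\<lambda>(h', j). case (i, j) of (Slot h a, Asg b) \<Rightarrow> of_bool (h = h' \<and> a = b) | _ \<Rightarrow> 0)
        \<circ> (\<lambda>h. (h, Asg (a h)))) {..<H} = (of_bool (i \<in> ?slots) :: real)"
      proof (cases i)
        case (Slot h b)
        then show ?thesis using sum[of h b] by (simp add: comp_def image_iff del: sum_of_bool_eq)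
      qed auto
    qed
  qed
  moreover have "last ?zs = e {St v}"
    using assms(2) by (simp add: last_map v_def del: upt_Suc)
  \<comment> \<open>The residual connection supplies the state. As \<open>St v\<close> is not a
    slot, no coordinate of the sum exceeds 1.\<close>
  moreover have "e ?slots + e {St v} = e (insert (St v) ?slots)"
    by (intro eq_vecI) (auto simp: ind_def)
  moreover have "relu (W1 *\<^sub>v e (insert (St v) ?slots)) = e {Unit v (map a [0..<H])}"
  proof -
    have sub: "insert (St v) ?slots \<subseteq> coords" using vS a by (auto simp: coords_def)
    have inj: "inj_on (\<lambda>h. Slot h (a h)) {..<H}" by (auto intro: inj_onI)
    show ?thesis
      unfolding W1_def
    proof (rule relu_coord_mat_mult_ind_eq_ind[OF bij_\<iota> sub bij_\<iota>])
      fix i assume i: "i \<in> coords"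
      let ?M = "\<lambda>i j. case i of Unit v r \<Rightarrow>
        (case j of St u \<Rightarrow> of_bool (u = v) - real H | Slot h a \<Rightarrow> of_bool (r ! h = a) | _ \<Rightarrow> 0) | _ \<Rightarrow> 0"
      have "sum (?M i) (insert (St v) ?slots) = ?M i (St v) + (\<Sum>h<H. ?M i (Slot h (a h)))"
        by (subst sum.insert) (auto simp: sum.reindex[OF inj])
      moreover have "max 0 (?M i (St v) + (\<Sum>h<H. ?M i (Slot h (a h)))) = of_bool (i \<in> {Unit v (map a [0..<H])})"
      proof (cases i)
        case (Unit u r)
        then have "length r = H" using i by (auto simp: coords_def)
        then show ?thesis using relu_unit_eq[of r H "v = u" a] Unit by auto
      qed auto
      ultimately show "max 0 (sum (?M i) (insert (St v) ?slots)) = of_bool (i \<in> {Unit v (map a [0..<H])})"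
        by (simp only:)
    qed
  qed
  moreover have "W2 *\<^sub>v e {Unit v (map a [0..<H])} = e {St (\<delta> v (map a [0..<H]))}"
  proof -
    have "map a [0..<H] \<in> {r. set r \<subseteq> assignments n \<Sigma> \<and> length r = H}" using a by auto
    then have sub: "{Unit v (map a [0..<H])} \<subseteq> coords" using vS unfolding coords_def by blast
    show ?thesis
      unfolding W2_def
      by (rule coord_mat_mult_ind_eq_ind[OF bij_\<iota> sub bij_\<iota>]) (auto split: coord.split)
  qed
  ultimately show ?thesis
    unfolding layer_output_def Let_def a_def v_def by (simp only:)
qed

text \<open>The induction is over all smaller \<open>t\<close> because the layer reads the entire
  history, each token of which must be known to encode a state.\<close>

lemma decoder_state_eq:
  assumes w: "w \<in> words n \<Sigma>" and v: "\<And>t. v t \<in> S" "\<And>t. v (Suc t) = \<delta> (v t) (answers (v t) w)"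
  shows "decoder_state (layer_output H Qm (\<lambda>_. 1\<^sub>m d) W1 W2 WO)
    (map (\<lambda>i. e {Asg (i, w i)}) [1..<Suc n]) (e {St (v 0)}) t = e {St (v t)}"
proof (induction t rule: less_induct)
  case (less t)
  show ?case
  proof (cases t)
    case (Suc s)
    let ?L = "layer_output H Qm (\<lambda>_. 1\<^sub>m d) W1 W2 WO" and ?xs = "map (\<lambda>i. e {Asg (i, w i)}) [1..<Suc n]"
    have "map (decoder_state ?L ?xs (e {St (v 0)})) [0..<Suc s] = map (\<lambda>v. e {St v}) (map v [0..<Suc s])"
      unfolding map_map comp_def using Suc by (intro map_cong refl less) auto
    then have "decoder_state ?L ?xs (e {St (v 0)}) (Suc s)
      = ?L (?xs @ map (\<lambda>v. e {St v}) (map v [0..<Suc s]))"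
      by (simp only: decoder_state.simps)
    also have "\<dots> = e {St (\<delta> (last (map v [0..<Suc s])) (answers (last (map v [0..<Suc s])) w))}"
      using v(1) by (intro layer_output_eq w) auto
    also have "last (map v [0..<Suc s]) = v s" by simp
    finally show ?thesis by (simp only: Suc v(2))
  qed simp
qed

lemma inj_on_e: "inj_on (\<lambda>v. e {St v}) S"
proof (rule inj_onI)
  fix u v assume u: "u \<in> S" "v \<in> S" and eq: "e {St u} = e {St v}"
  then have "St u \<in> \<iota> ` {..<d}" unfolding bij_betw_imp_surj_on[OF bij_\<iota>] by (auto simp: coords_def)
  then obtain k where k: "k < d" "\<iota> k = St u" by auto
  then have "e {St v} $ k = 1" unfolding eq[symmetric] by (simp add: ind_def)
  then show "u = v" using k by (simp add: ind_def split: if_splits)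
qed

text \<open>The runs \<open>v w\<close> depend on the word, but they share the start state
  \<open>v0\<close>, because it is encoded in the embedding of \<open>EoL\<close>.\<close>

lemma decoder_computes_automaton:
  assumes out: "Out \<noteq> {}" "g \<in> S \<rightarrow> Out"
    and v: "\<And>w s. w \<in> words n \<Sigma> \<Longrightarrow> v w s \<in> S"
      "\<And>w s. w \<in> words n \<Sigma> \<Longrightarrow> v w (Suc s) = \<delta> (v w s) (answers (v w s) w)"
      "\<And>w. w \<in> words n \<Sigma> \<Longrightarrow> v w 0 = v0"
    and f: "\<And>w. w \<in> words n \<Sigma> \<Longrightarrow> f w = g (v w t)"
  shows "decoder_computes H n \<Sigma> Out f t"
proof -
  let ?L = "layer_output H Qm (\<lambda>_. 1\<^sub>m d) W1 W2 WO"
  define p where "p = (\<lambda>x. case x of Sym \<sigma> i \<Rightarrow> e {Asg (i, \<sigma>)} | EoL \<Rightarrow> e {St v0})"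
  \<comment> \<open>Distinct states have distinct encodings, so the state can be read off the last
    token. Vectors that encode no state get some element of \<open>Out\<close>, which makes the
    output function total into \<open>Out\<close>.\<close>
  define \<alpha> where "\<alpha> = (\<lambda>y. if y \<in> (\<lambda>v. e {St v}) ` S then g (inv_into S (\<lambda>v. e {St v}) y)
    else SOME c. c \<in> Out)"
  have "is_attention_layer H d ?L"
    unfolding is_attention_layer_def
    by (intro exI[of _ Qm] exI[of _ "\<lambda>_. 1\<^sub>m d"] exI[of _ W1] exI[of _ W2] exI[of _ WO])
      (auto simp: Qm_def W1_def W2_def WO_def)
  moreover have "p \<in> tokens n \<Sigma> \<rightarrow> carrier_vec d"
    by (auto simp: p_def split: token.split)
  moreover have "\<alpha> \<in> carrier_vec d \<rightarrow> Out"
  proof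
    fix y
    have "g (inv_into S (\<lambda>v. e {St v}) y) \<in> Out" if "y \<in> (\<lambda>v. e {St v}) ` S"
      using inv_into_into[OF that] by (rule funcset_mem[OF out(2)])
    then show "\<alpha> y \<in> Out" using some_in_eq[of Out] out(1) by (simp add: \<alpha>_def)
  qed
  moreover have "f w = \<alpha> (decoder_state ?L (map (\<lambda>i. p (Sym (w i) i)) [1..<Suc n]) (p EoL) t)"
    if w: "w \<in> words n \<Sigma>" for w
    using decoder_state_eq[OF w, of "v w" t] v[OF w] f[OF w] inv_into_f_f[OF inj_on_e v(1)[OF w]]
    by (simp add: p_def \<alpha>_def del: upt_Suc)
  ultimately show ?thesis unfolding decoder_computes_def by blast
qed

end

section \<open>Decision trees as automata on their subtrees\<close>

primrec subtrees :: "'w set \<Rightarrow> ('w, 'r, 'o) dtree \<Rightarrow> ('w, 'r, 'o) dtree set" where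
  "subtrees D (Leaf c) = {Leaf c}"
| "subtrees D (Node q ch) = insert (Node q ch) (\<Union>r\<in>q ` D. subtrees D (ch r))"

text \<open>A leaf loops, so that short branches wait while longer ones are still running.\<close>

primrec dtree_step :: "('w, 'r, 'o) dtree \<Rightarrow> 'r \<Rightarrow> ('w, 'r, 'o) dtree" where
  "dtree_step (Leaf c) r = Leaf c"
| "dtree_step (Node q ch) r = ch r"

text \<open>A decoder asks in every iteration, also after a leaf is reached. There it asks the dummy
  \<open>q0\<close>, whose answer \<open>dtree_step\<close> ignores.\<close>

primrec dtree_query :: "('w \<Rightarrow> 'r) \<Rightarrow> ('w, 'r, 'o) dtree \<Rightarrow> 'w \<Rightarrow> 'r" where
  "dtree_query q0 (Leaf c) = q0"
| "dtree_query q0 (Node q ch) = q"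

primrec leaf_label :: "'o \<Rightarrow> ('w, 'r, 'o) dtree \<Rightarrow> 'o" where
  "leaf_label c0 (Leaf c) = c"
| "leaf_label c0 (Node q ch) = c0"

text \<open>Only labels attained on \<open>D\<close> are followed, which bounds the branching even
  if the label type is infinite. Finiteness makes the subtrees usable as states of the
  automaton.\<close>

lemma finite_subtrees: "finite D \<Longrightarrow> finite (subtrees D T)"
  by (induction T) auto

lemma self_in_subtrees: "T \<in> subtrees D T"
  by (cases T) auto

lemma is_dtree_over_subtree: "is_dtree_over D F Out T \<Longrightarrow> U \<in> subtrees D T \<Longrightarrow> is_dtree_over D F Out U"
  by (induction T) auto

lemma dtree_step_in_subtrees:
  "U \<in> subtrees D T \<Longrightarrow> w \<in> D \<Longrightarrow> dtree_step U (dtree_query q0 U w) \<in> subtrees D T"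
proof (induction T)
  case (Node q ch)
  show ?case
  proof (cases "U = Node q ch")
    case True
    then show ?thesis using Node.prems self_in_subtrees by fastforce
  next
    case False
    then obtain r where "r \<in> q ` D" "U \<in> subtrees D (ch r)" using Node.prems by auto
    then show ?thesis using Node.IH[of "ch r"] Node.prems by auto
  qed
qed simp

text \<open>A step at an inner node lowers the depth by at least one and a step at a leaf changes
  nothing, so after \<open>t\<close> steps the run rests in the leaf that the word reaches.\<close>

lemma leaf_label_funpow_step:
  assumes D: "finite D" and w: "w \<in> D"
  shows "dtree_depth D T \<le> t \<Longrightarrow>
    leaf_label c0 (((\<lambda>U. dtree_step U (dtree_query q0 U w)) ^^ t) T) = dtree_output T w"
proof (induction t arbitrary: T)
  case 0
  then show ?case by (cases T) auto
next
  case (Suc t)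
  have "dtree_depth D (dtree_step T (dtree_query q0 T w)) \<le> t"
  proof (cases T)
    case (Node q ch)
    then have "dtree_depth D (ch (q w)) \<le> Max ((\<lambda>r. dtree_depth D (ch r)) ` q ` D)"
      using D w by (intro Max_ge) auto
    then show ?thesis using Suc.prems Node by simp
  qed simp
  moreover have "dtree_output (dtree_step T (dtree_query q0 T w)) w = dtree_output T w" by (cases T) auto
  ultimately show ?case using Suc.IH by (simp add: funpow_Suc_right del: funpow.simps(2))
qed

text \<open>The states are the subtrees of \<open>T\<close>. Equal subtrees at different nodes share
  a state, which is harmless because a subtree determines the rest of the run.\<close>

lemma dtree_imp_decoder:
  fixes \<Sigma> :: "nat \<Rightarrow> 'a set" and Out :: "'o set"
  assumes n: "n \<ge> 1" and fin: "\<And>i. i \<in> {1..n} \<Longrightarrow> finite (\<Sigma> i)" and out: "Out \<noteq> {}"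
    and T: "is_dtree_over (words n \<Sigma>) (a_queries H n \<Sigma>) Out T"
    and f: "\<And>w. w \<in> words n \<Sigma> \<Longrightarrow> dtree_output T w = f w"
  shows "decoder_computes H n \<Sigma> Out f (dtree_depth (words n \<Sigma>) T)"
proof -
  let ?D = "words n \<Sigma>"
  let ?S = "subtrees ?D T"
  have finD: "finite ?D" using fin by (auto simp: words_def intro!: finite_PiE)
  have finA: "finite (assignments n \<Sigma>)" using fin by (rule finite_assignments)
  \<comment> \<open>Some permutation is needed to build the dummy query for leaves, since the
    decoder's heads can only realise a-queries; a constant key yields one.\<close>
  obtain \<tau>0 where \<tau>0: "is_permutation n \<Sigma> \<tau>0"
    unfolding is_permutation_def using ex_sorted_enumeration[OF finA, of "\<lambda>_. 0 :: nat"] by blast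
  obtain c0 where c0: "c0 \<in> Out" using out by blast
  define q0 where "q0 = (\<lambda>w. map (\<lambda>t. a_query n \<Sigma> t w) (replicate H \<tau>0))"
  have q0: "q0 \<in> a_queries H n \<Sigma>" unfolding a_queries_def q0_def
    by (intro CollectI exI[of _ "replicate H \<tau>0"]) (use \<tau>0 in auto)
  have "dtree_query q0 U \<in> a_queries H n \<Sigma>" if "U \<in> ?S" for U
    using is_dtree_over_subtree[OF T that] q0 by (cases U) auto
  then have "\<exists>\<tau>s. length \<tau>s = H \<and> (\<forall>t\<in>set \<tau>s. is_permutation n \<Sigma> t) \<and>
    dtree_query q0 U = (\<lambda>w. map (\<lambda>t. a_query n \<Sigma> t w) \<tau>s)" if "U \<in> ?S" for U
    using that unfolding a_queries_def by fast
  then obtain \<tau>s where \<tau>s: "\<And>U. U \<in> ?S \<Longrightarrow> length (\<tau>s U) = H"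
    "\<And>U t. U \<in> ?S \<Longrightarrow> t \<in> set (\<tau>s U) \<Longrightarrow> is_permutation n \<Sigma> t"
    "\<And>U. U \<in> ?S \<Longrightarrow> dtree_query q0 U = (\<lambda>w. map (\<lambda>t. a_query n \<Sigma> t w) (\<tau>s U))"
    by metis
  interpret query_automaton H n \<Sigma> ?S "\<lambda>U h. \<tau>s U ! h" dtree_step
    using n finA finite_subtrees[OF finD] \<tau>s by unfold_locales auto
  have answers: "answers U w = dtree_query q0 U w" if "U \<in> ?S" for U w
    using \<tau>s(1,3)[OF that] by (auto intro: nth_equalityI)
  define v where "v = (\<lambda>w s. ((\<lambda>U. dtree_step U (dtree_query q0 U w)) ^^ s) T)"
  have v: "v w s \<in> ?S" if "w \<in> ?D" for w s
    using that by (induction s) (auto simp: v_def self_in_subtrees intro: dtree_step_in_subtrees)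
  show ?thesis
  proof (rule decoder_computes_automaton[where v = v and g = "leaf_label c0" and ?v0.0 = T])
    show "leaf_label c0 \<in> ?S \<rightarrow> Out"
    proof
      fix U assume "U \<in> ?S"
      then show "leaf_label c0 U \<in> Out" using is_dtree_over_subtree[OF T, of U] c0 by (cases U) auto
    qed
    show "v w (Suc s) = dtree_step (v w s) (answers (v w s) w)" if "w \<in> ?D" for w s
      unfolding answers[OF v[OF that]] by (simp add: v_def)
    show "f w = leaf_label c0 (v w (dtree_depth ?D T))" if "w \<in> ?D" for w
      unfolding v_def by (subst leaf_label_funpow_step[OF finD that]) (auto simp: f[OF that])
  qed (use out v in \<open>auto simp: v_def\<close>)
qed

section \<open>Rank and decoder depth\<close>

theorem theorem2:
  fixes H n :: nat and \<Sigma> :: "nat \<Rightarrow> 'a set" and Out :: "'o set" and f :: "(nat \<Rightarrow> 'a) \<Rightarrow> 'o"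
  assumes "H \<ge> 1" and "n \<ge> 1"
    and "\<And>i. i \<in> {1..n} \<Longrightarrow> finite (\<Sigma> i) \<and> \<Sigma> i \<noteq> {}"
    and "finite Out" and "Out \<noteq> {}"
    and "f \<in> words n \<Sigma> \<rightarrow> Out"
  shows "head_rank H n \<Sigma> Out f = decoder_depth H n \<Sigma> Out f"
proof (rule antisym)
  let ?D = "words n \<Sigma>"
  show "head_rank H n \<Sigma> Out f \<le> decoder_depth H n \<Sigma> Out f"
    unfolding decoder_depth_def
  proof (rule INF_greatest)
    fix t assume "t \<in> {t. decoder_computes H n \<Sigma> Out f t}"
    then obtain d L p \<alpha> where L: "is_attention_layer H d L" and p: "p \<in> tokens n \<Sigma> \<rightarrow> carrier_vec d"
      and \<alpha>: "\<alpha> \<in> carrier_vec d \<rightarrow> Out"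
      and f: "\<And>w. w \<in> ?D \<Longrightarrow>
        f w = \<alpha> (decoder_state L (map (\<lambda>i. p (Sym (w i) i)) [1..<Suc n]) (p EoL) t)"
      unfolding decoder_computes_def by auto
    have "(case a of (i, \<sigma>) \<Rightarrow> p (Sym \<sigma> i)) \<in> carrier_vec d" if "a \<in> assignments n \<Sigma>" for a
      using that by (auto simp: assignments_def tokens_def intro!: funcset_mem[OF p])
    moreover have "p EoL \<in> carrier_vec d" by (intro funcset_mem[OF p]) (simp add: tokens_def)
    ultimately obtain T where T: "is_dtree_over ?D (a_queries H n \<Sigma>) Out T" "dtree_depth ?D T \<le> t"
      "\<And>w. w \<in> ?D \<Longrightarrow> dtree_output T w = \<alpha> (last (((\<lambda>zs. zs @ [L zs]) ^^ t)
         (map (\<lambda>i. case (i, w i) of (i, \<sigma>) \<Rightarrow> p (Sym \<sigma> i)) [1..<Suc n] @ [p EoL])))"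
      using decoder_imp_dtree[where \<Sigma> = \<Sigma> and p = "\<lambda>(i, \<sigma>). p (Sym \<sigma> i)" and ys = "[p EoL]" and t = t,
          OF assms(2,3) L _ \<alpha>] by auto
    then have "dtree_output T w = f w" if "w \<in> ?D" for w
      using that f[OF that] by (simp add: decoder_state_eq_last del: upt_Suc)
    then show "head_rank H n \<Sigma> Out f \<le> enat t"
      unfolding head_rank_def using T by (intro INF_lower2[of T]) auto
  qed
  show "decoder_depth H n \<Sigma> Out f \<le> head_rank H n \<Sigma> Out f"
    unfolding head_rank_def decoder_depth_def
  \<comment> \<open>A tree yields a decoder with exactly as many iterations as its depth, so that
    depth is itself a member of the set whose infimum is taken.\<close>
  proof (rule INF_greatest, rule INF_lower)
    fix T assume "T \<in> {T. is_dtree_over ?D (a_queries H n \<Sigma>) Out T \<and> (\<forall>w\<in>?D. dtree_output T w = f w)}"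
    then show "dtree_depth ?D T \<in> {t. decoder_computes H n \<Sigma> Out f t}"
      using assms by (auto intro!: dtree_imp_decoder)
  qed
qed

end
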